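(* Let $g\ge 2$ be an integer, $n>0$, $\sigma>0$ and $c>1$. For a design $\xi=((x_0,\dots,x_{g-1}),(n_0,\dots,n_{g-1}))$, with nodes $-1\le x_0<\dots<x_{g-1}\le 1$ and real frequencies $n_j>0$ satisfying $\sum_{j=0}^{g-1}n_j=n$, put $$V_\xi(x)=\sigma^2\sum_{j=0}^{g-1}\frac{l_j(x)^2}{n_j},\qquad l_j(x)=\prod_{k\ne j}\frac{x-x_k}{x_j-x_k}.$$ Let $\xi_c$ be the Hoel–Levine design at $c$ (defined in the context). Then $\xi_c$ is minimax optimal on $[1,c]$, i.e. it solves $$\min_{\xi}\ \max_{x\in[1,c]}V_\xi(x),$$ where the minimum is over all designs $\xi=((x_0,\dots,x_{g-1}),(n_0,\dots,n_{g-1}))$ with $-1\le x_0<\dots<x_{g-1}\le 1$, real $n_j>0$ and $\sum_{j=0}^{g-1}n_j=n$.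
   Context: The Hoel–Levine design $\xi_c$ at $c$ is the design whose nodes are the Chebyshev nodes $\cos\left(\frac{k\pi}{g-1}\right)$, $k=0,\dots,g-1$ (relabelled in increasing order as $x_0<\dots<x_{g-1}$), and whose frequencies are $n_j=n\,\frac{|l_j(c)|}{\sum_{i=0}^{g-1}|l_i(c)|}$, where $l_0,\dots,l_{g-1}$ are the elementary Lagrange polynomials of these nodes. Frequencies are allowed to be positive real numbers. $V_\xi(x)$ is the variance at $x$ of the Lagrange-interpolation estimator of a polynomial of degree at most $g-1$ observed with noise of variance $\sigma^2$, with $n_j$ independent replications at node $x_j$. *)

theory Defs
  imports "HOL-Analysis.Analysis"
begin

text \<open>
  A design is a pair (nodes, frequencies). For a design with \<open>g\<close> nodes only the values at
  the indices \<open>0, \<dots>, g - 1\<close> are relevant.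
\<close>

type_synonym design = "(nat \<Rightarrow> real) \<times> (nat \<Rightarrow> real)"

definition is_design :: "nat \<Rightarrow> real \<Rightarrow> design \<Rightarrow> bool" where
  "is_design g n \<xi> \<longleftrightarrow>
     (\<forall>j<g. fst \<xi> j \<in> {-1..1}) \<and> strict_mono_on {..<g} (fst \<xi>) \<and>
     (\<forall>j<g. 0 < snd \<xi> j) \<and> (\<Sum>j<g. snd \<xi> j) = n"

definition lagrange :: "nat \<Rightarrow> (nat \<Rightarrow> real) \<Rightarrow> nat \<Rightarrow> real \<Rightarrow> real" where
  "lagrange g X j x = (\<Prod>k\<in>{..<g} - {j}. (x - X k) / (X j - X k))"

definition design_variance :: "nat \<Rightarrow> real \<Rightarrow> design \<Rightarrow> real \<Rightarrow> real" where
  "design_variance g \<sigma> \<xi> x = \<sigma>\<^sup>2 * (\<Sum>j<g. (lagrange g (fst \<xi>) j x)\<^sup>2 / snd \<xi> j)"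

text \<open>
  On a compact interval the supremum below is a maximum, see
  \<open>max_design_variance_attained\<close>.
\<close>

definition max_design_variance :: "nat \<Rightarrow> real \<Rightarrow> real set \<Rightarrow> design \<Rightarrow> real" where
  "max_design_variance g \<sigma> S \<xi> = (SUP x\<in>S. design_variance g \<sigma> \<xi> x)"

definition minimax_optimal :: "nat \<Rightarrow> real \<Rightarrow> real \<Rightarrow> real set \<Rightarrow> design \<Rightarrow> bool" where
  "minimax_optimal g n \<sigma> S \<xi> \<longleftrightarrow> is_arg_min (max_design_variance g \<sigma> S) (is_design g n) \<xi>"

text \<open>
  The points \<open>cos (k * pi / (g - 1))\<close> decrease in \<open>k\<close>, so the increasing labelling is
  obtained by replacing \<open>k\<close> with \<open>g - 1 - j\<close>.
\<close>

definition chebyshev_node :: "nat \<Rightarrow> nat \<Rightarrow> real" where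
  "chebyshev_node g j = cos (real (g - 1 - j) * pi / real (g - 1))"

definition hoel_levine :: "nat \<Rightarrow> real \<Rightarrow> real \<Rightarrow> design" where
  "hoel_levine g n c =
     (chebyshev_node g,
      \<lambda>j. n * \<bar>lagrange g (chebyshev_node g) j c\<bar>
            / (\<Sum>i<g. \<bar>lagrange g (chebyshev_node g) i c\<bar>))"

lemma max_design_variance_attained:
  assumes "a \<le> b"
  shows "\<exists>x\<in>{a..b}. design_variance g \<sigma> \<xi> x = max_design_variance g \<sigma> {a..b} \<xi> \<and>
           (\<forall>y\<in>{a..b}. design_variance g \<sigma> \<xi> y \<le> design_variance g \<sigma> \<xi> x)"
proof -
  have "continuous_on {a..b} (design_variance g \<sigma> \<xi>)"
    unfolding design_variance_def lagrange_def divide_inverse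
    by (intro continuous_intros)
  then obtain x where x: "x \<in> {a..b}"
    and le: "\<forall>y\<in>{a..b}. design_variance g \<sigma> \<xi> y \<le> design_variance g \<sigma> \<xi> x"
    using continuous_attains_sup[of "{a..b}" "design_variance g \<sigma> \<xi>"] assms by auto
  have "max_design_variance g \<sigma> {a..b} \<xi> = design_variance g \<sigma> \<xi> x"
    unfolding max_design_variance_def using x le by (intro cSup_eq_maximum) auto
  with x le show ?thesis by auto
qed

lemma strict_mono_chebyshev_node: "strict_mono_on {..<g} (chebyshev_node g)"
proof (rule strict_mono_onI)
  fix i j assume ij: "i \<in> {..<g}" "j \<in> {..<g}" "i < j"
  then have "real (g - 1 - j) < real (g - 1 - i)" and pos: "0 < real (g - 1)"
    and le: "real (g - 1 - i) \<le> real (g - 1)"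
    by auto
  then have "real (g - 1 - j) * pi / real (g - 1) < real (g - 1 - i) * pi / real (g - 1)"
    by (intro divide_strict_right_mono mult_strict_right_mono) auto
  moreover have "real (g - 1 - i) * pi / real (g - 1) \<le> pi"
    using pos le by (simp add: divide_le_eq mult.commute)
  ultimately show "chebyshev_node g i < chebyshev_node g j"
    unfolding chebyshev_node_def by (intro cos_monotone_0_pi) auto
qed

lemma chebyshev_node_image:
  "chebyshev_node g ` {..<g} = (\<lambda>k. cos (real k * pi / real (g - 1))) ` {..<g}"
proof -
  have "(\<lambda>j. g - 1 - j) ` {..<g} = {..<g}"
  proof (intro equalityI subsetI)
    fix k assume "k \<in> {..<g}"
    then have "k = g - 1 - (g - 1 - k)" "g - 1 - k \<in> {..<g}" by auto
    then show "k \<in> (\<lambda>j. g - 1 - j) ` {..<g}" by blast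
  qed auto
  then have "(\<lambda>k. cos (real k * pi / real (g - 1))) ` {..<g} =
      (\<lambda>k. cos (real k * pi / real (g - 1))) ` ((\<lambda>j. g - 1 - j) ` {..<g})"
    by simp
  then show ?thesis
    by (simp add: image_image chebyshev_node_def)
qed

end

(* The Chebyshev polynomial T of degree g - 1 is bounded by 1 on [-1, 1] and takes the values
   +1 and -1 alternately at the Chebyshev nodes.  For any design, Cauchy-Schwarz gives
   V(c) >= sigma^2 (sum |l_j(c)|)^2 / n, and expanding T in the Lagrange basis of the design gives
   sum |l_j(c)| >= T(c).  For the Hoel-Levine design both inequalities are equalities, because
   the signs of l_j(c) alternate in the same way as those of T at the nodes.  Finally, to the right
   of all nodes every |l_j| is increasing, so the maximum of V over [1, c] is attained at c. *)

theory Submission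
  imports Defs
begin

section \<open>Chebyshev polynomials of the first kind\<close>

fun chebyshev_poly :: "nat \<Rightarrow> real poly" where
  "chebyshev_poly 0 = 1"
| "chebyshev_poly (Suc 0) = [:0, 1:]"
| "chebyshev_poly (Suc (Suc m)) = [:0, 2:] * chebyshev_poly (Suc m) - chebyshev_poly m"

lemma degree_chebyshev_poly_le: "degree (chebyshev_poly m) \<le> m"
proof (induction m rule: chebyshev_poly.induct)
  case (3 m)
  have "degree ([:0, 2:] * chebyshev_poly (Suc m)) \<le> degree [:0, 2 :: real:] + degree (chebyshev_poly (Suc m))"
    by (rule degree_mult_le)
  also have "\<dots> \<le> Suc (Suc m)" using 3 by simp
  finally show ?case using 3 by (simp del: mult_pCons_left add: degree_diff_le)
qed auto

text \<open>The recurrence mirrors \<open>cos (s + t) + cos (s - t) = 2 * cos s * cos t\<close> with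
  \<open>s = (m + 1) * t\<close>.\<close>

lemma poly_chebyshev_poly_cos: "poly (chebyshev_poly m) (cos t) = cos (real m * t)"
proof (induction m rule: chebyshev_poly.induct)
  case (3 m)
  have "cos (real (Suc (Suc m)) * t) = cos (real (Suc m) * t + t)"
    by (simp add: algebra_simps)
  moreover have "cos (real m * t) = cos (real (Suc m) * t - t)"
    by (simp add: algebra_simps)
  ultimately show ?case
    using 3 by (simp add: cos_add cos_diff)
qed auto

lemma abs_poly_chebyshev_poly_le_1:
  assumes "x \<in> {-1..1}"
  shows "\<bar>poly (chebyshev_poly m) x\<bar> \<le> 1"
proof -
  have "poly (chebyshev_poly m) (cos (arccos x)) = cos (real m * arccos x)"
    by (rule poly_chebyshev_poly_cos)
  with assms show ?thesis by simp
qed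

text \<open>Multiplying the angle of the node by \<open>g - 1\<close> leaves an integer multiple of
  \<open>pi\<close>. The exponent counts from the right because the nodes are labelled in increasing
  order.\<close>

lemma poly_chebyshev_poly_chebyshev_node:
  assumes "g \<ge> 2"
  shows "poly (chebyshev_poly (g - 1)) (chebyshev_node g j) = (-1) ^ (g - 1 - j)"
proof -
  have "real (g - 1) * (real (g - 1 - j) * pi / real (g - 1)) = real (g - 1 - j) * pi"
    using assms by simp
  then show ?thesis
    unfolding chebyshev_node_def poly_chebyshev_poly_cos by (simp only: cos_npi)
qed

section \<open>Lagrange interpolation, and the basis to the right of the nodes\<close>

lemma lagrange_node:
  assumes "inj_on X {..<g}" "i < g" "j < g"
  shows "lagrange g X j (X i) = (if i = j then 1 else 0)"
proof (cases "i = j")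
  case True
  have "(X j - X k) / (X j - X k) = 1" if "k \<in> {..<g} - {j}" for k
    using that assms by (auto dest: inj_onD)
  with True show ?thesis by (simp add: lagrange_def)
next
  case False
  with assms show ?thesis by (auto simp: lagrange_def)
qed

text \<open>Both sides are polynomials of degree below \<open>g\<close> that agree at
  \<open>g\<close> distinct nodes.\<close>

lemma lagrange_interpolation:
  assumes X: "inj_on X {..<g}" and deg: "degree p < g"
  shows "poly p x = (\<Sum>j<g. poly p (X j) * lagrange g X j x)"
proof -
  \<comment> \<open>\<open>lagrange\<close> is only a real function; \<open>L j\<close> is the same
    product as a formal polynomial, so that its degree can be bounded.\<close>
  define L where "L j = (\<Prod>k\<in>{..<g} - {j}. smult (1 / (X j - X k)) [:- X k, 1:])" for j
  have L: "poly (L j) y = lagrange g X j y" for j y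
    by (simp add: L_def lagrange_def poly_prod diff_divide_distrib)
  have deg_L: "degree (L j) \<le> g - 1" if "j < g" for j
  proof -
    have "degree (L j) \<le> (\<Sum>k\<in>{..<g} - {j}. degree (smult (1 / (X j - X k)) [:- X k, 1:]))"
      unfolding L_def
      using degree_prod_sum_le[of "{..<g} - {j}" "\<lambda>k. smult (1 / (X j - X k)) [:- X k, 1:]"]
      by (simp only: comp_def finite_Diff finite_lessThan)
    also have "\<dots> \<le> (\<Sum>k\<in>{..<g} - {j}. 1)"
      by (intro sum_mono order_trans[OF degree_smult_le]) simp
    also have "\<dots> = g - 1" using that by simp
    finally show ?thesis .
  qed
  define q where "q = (\<Sum>j<g. smult (poly p (X j)) (L j))"
  have q: "poly q y = (\<Sum>j<g. poly p (X j) * lagrange g X j y)" for y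
    by (simp add: q_def poly_sum L)
  have "p = q"
  proof (rule poly_eqI_degree)
    fix y assume "y \<in> X ` {..<g}"
    then obtain i where i: "i < g" "y = X i" by auto
    have "poly q y = (\<Sum>j<g. if i = j then poly p (X j) else 0)"
      unfolding q i(2) using X i by (intro sum.cong) (auto simp: lagrange_node)
    with i show "poly p y = poly q y" by simp
  next
    show "card (X ` {..<g}) > degree p" using X deg by (simp add: card_image)
    have "degree (smult (poly p (X j)) (L j)) \<le> g - 1" if "j < g" for j
      using degree_smult_le deg_L[OF that] by (rule order_trans)
    then have "degree q \<le> g - 1"
      unfolding q_def by (intro degree_sum_le) simp_all
    then show "card (X ` {..<g}) > degree q" using X deg by (simp add: card_image)
  qed
  then show ?thesis by (metis q)
qed

text \<open>To the right of the nodes a factor can be negative only through its denominator, that is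
  for the \<open>g - 1 - j\<close> indices \<open>k > j\<close>. Stated as a product of sign and
  absolute value, this also covers the case where \<open>x\<close> is a node and the value may be
  zero.\<close>

lemma lagrange_eq_sign_mult_abs:
  assumes X: "strict_mono_on {..<g} X" and "j < g" and x: "\<And>k. k < g \<Longrightarrow> X k \<le> x"
  shows "lagrange g X j x = (-1) ^ (g - 1 - j) * \<bar>lagrange g X j x\<bar>"
proof -
  have "(\<Prod>k\<in>{..<g} - {j}. (x - X k) / (X j - X k)) =
      (\<Prod>k\<in>{..<g} - {j}. (if j < k then -1 else 1) * \<bar>(x - X k) / (X j - X k)\<bar>)"
  proof (rule prod.cong)
    fix k assume k: "k \<in> {..<g} - {j}"
    then have "if j < k then X j < X k else X k < X j"
      using X \<open>j < g\<close> by (auto simp: strict_mono_on_def)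
    with x[of k] k show "(x - X k) / (X j - X k) =
        (if j < k then -1 else 1) * \<bar>(x - X k) / (X j - X k)\<bar>"
      by (auto simp: abs_divide field_simps split: if_splits)
  qed simp
  also have "\<dots> = (\<Prod>k\<in>{..<g} - {j}. if j < k then -1 else 1) * \<bar>lagrange g X j x\<bar>"
    by (simp only: prod.distrib lagrange_def abs_prod)
  also have "(\<Prod>k\<in>{..<g} - {j}. if j < k then -1 else 1 :: real) = (\<Prod>k\<in>{j<..<g}. -1)"
    by (intro prod.mono_neutral_cong_right) auto
  also have "\<dots> = (-1) ^ (g - 1 - j)" by simp
  finally show ?thesis by (simp add: lagrange_def)
qed

text \<open>Moving right increases the distance to every node, while the denominators stay
  fixed.\<close>

lemma abs_lagrange_mono:
  assumes "\<And>k. k < g \<Longrightarrow> X k \<le> x" "x \<le> y"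
  shows "\<bar>lagrange g X j x\<bar> \<le> \<bar>lagrange g X j y\<bar>"
  unfolding lagrange_def abs_prod
proof (intro prod_mono conjI)
  fix k assume "k \<in> {..<g} - {j}"
  then have "X k \<le> x" using assms by simp
  then have "\<bar>x - X k\<bar> \<le> \<bar>y - X k\<bar>" using assms(2) by simp
  then show "\<bar>(x - X k) / (X j - X k)\<bar> \<le> \<bar>(y - X k) / (X j - X k)\<bar>"
    by (simp only: abs_divide divide_right_mono abs_ge_zero)
qed simp

lemma lagrange_nonzero:
  assumes "inj_on X {..<g}" "j < g" "\<And>k. k < g \<Longrightarrow> X k < x"
  shows "lagrange g X j x \<noteq> 0"
proof -
  have "(x - X k) / (X j - X k) \<noteq> 0" if "k \<in> {..<g} - {j}" for k
    using assms(3)[of k] inj_onD[OF assms(1), of j k] assms(2) that by auto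
  then show ?thesis by (simp add: lagrange_def)
qed

section \<open>The sum of the absolute Lagrange values\<close>

lemma chebyshev_poly_le_sum_abs_lagrange:
  assumes X: "inj_on X {..<g}" and X1: "\<And>j. j < g \<Longrightarrow> X j \<in> {-1..1}" and "g \<ge> 1"
  shows "\<bar>poly (chebyshev_poly (g - 1)) x\<bar> \<le> (\<Sum>j<g. \<bar>lagrange g X j x\<bar>)"
proof -
  have "degree (chebyshev_poly (g - 1)) < g"
    using degree_chebyshev_poly_le[of "g - 1"] \<open>g \<ge> 1\<close> by linarith
  then have "\<bar>poly (chebyshev_poly (g - 1)) x\<bar> =
      \<bar>\<Sum>j<g. poly (chebyshev_poly (g - 1)) (X j) * lagrange g X j x\<bar>"
    using lagrange_interpolation[OF X] by simp
  also have "\<dots> \<le> (\<Sum>j<g. \<bar>poly (chebyshev_poly (g - 1)) (X j) * lagrange g X j x\<bar>)"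
    by (rule sum_abs)
  also have "\<dots> \<le> (\<Sum>j<g. \<bar>lagrange g X j x\<bar>)"
    \<comment> \<open>The coefficients are the values of the Chebyshev polynomial at nodes in
      [-1, 1], hence at most 1 in absolute value.\<close>
    unfolding abs_mult using X1
    by (intro sum_mono mult_left_le_one_le abs_poly_chebyshev_poly_le_1) auto
  finally show ?thesis .
qed

lemma chebyshev_node_le_1: "chebyshev_node g j \<le> 1"
  by (simp add: chebyshev_node_def)

text \<open>At the Chebyshev nodes the coefficients of the interpolation formula are exactly the
  signs of the basis values at \<open>x\<close>, so every term becomes an absolute value.\<close>

lemma sum_abs_lagrange_chebyshev_node:
  assumes "g \<ge> 2" "x \<ge> 1"
  shows "(\<Sum>j<g. \<bar>lagrange g (chebyshev_node g) j x\<bar>) = poly (chebyshev_poly (g - 1)) x"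
proof -
  have inj: "inj_on (chebyshev_node g) {..<g}"
    using strict_mono_chebyshev_node by (rule strict_mono_on_imp_inj_on)
  have deg: "degree (chebyshev_poly (g - 1)) < g"
    using degree_chebyshev_poly_le[of "g - 1"] assms by linarith
  have "\<bar>lagrange g (chebyshev_node g) j x\<bar> =
      (-1) ^ (g - 1 - j) * lagrange g (chebyshev_node g) j x" if "j < g" for j
  proof -
    have "chebyshev_node g k \<le> x" for k
      using chebyshev_node_le_1 assms(2) by (rule order_trans)
    then have "lagrange g (chebyshev_node g) j x =
        (-1) ^ (g - 1 - j) * \<bar>lagrange g (chebyshev_node g) j x\<bar>"
      using lagrange_eq_sign_mult_abs[OF strict_mono_chebyshev_node that] by blast
    then have "(-1) ^ (g - 1 - j) * lagrange g (chebyshev_node g) j x =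
        ((-1) ^ (g - 1 - j) * (-1) ^ (g - 1 - j)) * \<bar>lagrange g (chebyshev_node g) j x\<bar>"
      by (simp only: mult.assoc)
    then show ?thesis by (simp only: minus_one_mult_self mult_1_left)
  qed
  then show ?thesis
    using lagrange_interpolation[OF inj deg, of x] assms
    by (simp add: poly_chebyshev_poly_chebyshev_node[simplified])
qed

section \<open>Bounds for the variance\<close>

lemma design_variance_lower_bound:
  assumes "is_design g n \<xi>" "n > 0"
  shows "\<sigma>\<^sup>2 * (\<Sum>j<g. \<bar>lagrange g (fst \<xi>) j x\<bar>)\<^sup>2 / n \<le> design_variance g \<sigma> \<xi> x"
proof -
  let ?l = "\<lambda>j. \<bar>lagrange g (fst \<xi>) j x\<bar>" and ?w = "snd \<xi>"
  have w: "?w j > 0" if "j < g" for j using assms that by (simp add: is_design_def)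
  \<comment> \<open>Each term is split so that Cauchy-Schwarz yields the variance sum times the
    total frequency \<open>n\<close>.\<close>
  have "(\<Sum>j<g. ?l j)\<^sup>2 = (\<Sum>j<g. (?l j / sqrt (?w j)) * sqrt (?w j))\<^sup>2"
    using w by (intro arg_cong[where f = "\<lambda>x. x\<^sup>2"] sum.cong) (auto dest: w)
  also have "\<dots> \<le> (\<Sum>j<g. (?l j / sqrt (?w j))\<^sup>2) * (\<Sum>j<g. (sqrt (?w j))\<^sup>2)"
    by (rule Cauchy_Schwarz_ineq_sum)
  also have "(\<Sum>j<g. (?l j / sqrt (?w j))\<^sup>2) = (\<Sum>j<g. (lagrange g (fst \<xi>) j x)\<^sup>2 / ?w j)"
    using w by (intro sum.cong) (auto simp: power_divide less_imp_le)
  also have "(\<Sum>j<g. (sqrt (?w j))\<^sup>2) = n"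
  proof -
    have "(\<Sum>j<g. (sqrt (?w j))\<^sup>2) = (\<Sum>j<g. ?w j)"
      using w by (intro sum.cong) (auto simp: less_imp_le)
    then show ?thesis using assms by (simp add: is_design_def)
  qed
  finally have "(\<Sum>j<g. ?l j)\<^sup>2 / n \<le> (\<Sum>j<g. (lagrange g (fst \<xi>) j x)\<^sup>2 / ?w j)"
    using assms(2) by (simp add: divide_le_eq)
  from mult_left_mono[OF this, of "\<sigma>\<^sup>2"] show ?thesis by (simp add: design_variance_def)
qed

lemma abs_lagrange_chebyshev_node_pos:
  assumes "c > 1" "j < g"
  shows "0 < \<bar>lagrange g (chebyshev_node g) j c\<bar>"
proof -
  have "chebyshev_node g k < c" for k
    using chebyshev_node_le_1 assms(1) by (rule le_less_trans)
  then show ?thesis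
    using lagrange_nonzero[OF strict_mono_on_imp_inj_on[OF strict_mono_chebyshev_node] assms(2)]
    by simp
qed

text \<open>As \<open>c\<close> lies strictly to the right of all nodes, no basis polynomial
  vanishes there, so all frequencies are positive; the normalising sum makes their total
  \<open>n\<close>.\<close>

lemma is_design_hoel_levine:
  assumes "g \<ge> 1" "n > 0" "c > 1"
  shows "is_design g n (hoel_levine g n c)"
proof -
  let ?l = "\<lambda>j. \<bar>lagrange g (chebyshev_node g) j c\<bar>"
  have l: "?l j > 0" if "j < g" for j
    using assms(3) that by (rule abs_lagrange_chebyshev_node_pos)
  have S: "(\<Sum>i<g. ?l i) > 0"
    using assms by (intro sum_pos l) (auto simp: lessThan_empty_iff)
  have "(\<Sum>j<g. n * ?l j / (\<Sum>i<g. ?l i)) = n"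
    unfolding sum_divide_distrib[symmetric] sum_distrib_left[symmetric] using S by simp
  with S show ?thesis
    using assms l strict_mono_chebyshev_node[of g]
    by (auto simp: is_design_def hoel_levine_def chebyshev_node_def[of g]
        simp del: zero_less_abs_iff intro!: divide_pos_pos mult_pos_pos)
qed

text \<open>The bound is the variance at \<open>c\<close> itself; it carries over to smaller
  \<open>x\<close> because each |l_j| is at most its value at \<open>c\<close>.\<close>

lemma design_variance_hoel_levine_le:
  assumes "g \<ge> 2" "n > 0" "x \<in> {1..c}" "c > 1"
  shows "design_variance g \<sigma> (hoel_levine g n c) x
    \<le> \<sigma>\<^sup>2 * (poly (chebyshev_poly (g - 1)) c)\<^sup>2 / n"
proof -
  let ?l = "lagrange g (chebyshev_node g)" and ?T = "poly (chebyshev_poly (g - 1)) c"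
  have T: "(\<Sum>j<g. \<bar>?l j c\<bar>) = ?T"
    using assms by (intro sum_abs_lagrange_chebyshev_node) auto
  have "?T \<ge> 0" unfolding T[symmetric] by (intro sum_nonneg) simp
  \<comment> \<open>The denominator is the Hoel-Levine frequency, with its normalising sum replaced
    by \<open>?T\<close>. The right-hand sides add up to \<open>?T\<^sup>2 / n\<close>.\<close>
  have "(?l j x)\<^sup>2 / (n * \<bar>?l j c\<bar> / ?T) \<le> ?T / n * \<bar>?l j c\<bar>" if "j < g" for j
  proof -
    have pos: "\<bar>?l j c\<bar> > 0" using assms(4) that by (rule abs_lagrange_chebyshev_node_pos)
    have "chebyshev_node g k \<le> x" for k
      using chebyshev_node_le_1[of g k] assms(3) by simp
    then have "\<bar>?l j x\<bar> \<le> \<bar>?l j c\<bar>"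
      using assms(3) by (intro abs_lagrange_mono) auto
    then have "(?l j x)\<^sup>2 \<le> \<bar>?l j c\<bar>\<^sup>2"
      by (simp only: power2_abs abs_le_square_iff)
    then have "(?l j x)\<^sup>2 / \<bar>?l j c\<bar> \<le> \<bar>?l j c\<bar>"
      using pos by (simp only: divide_le_eq power2_eq_square if_True)
    then have "?T / n * ((?l j x)\<^sup>2 / \<bar>?l j c\<bar>) \<le> ?T / n * \<bar>?l j c\<bar>"
      using \<open>?T \<ge> 0\<close> assms(2) by (intro mult_left_mono) auto
    then show ?thesis by (simp add: mult_ac)
  qed
  then have "(\<Sum>j<g. (?l j x)\<^sup>2 / (n * \<bar>?l j c\<bar> / ?T)) \<le> (\<Sum>j<g. ?T / n * \<bar>?l j c\<bar>)"
    by (intro sum_mono) auto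
  also have "\<dots> = ?T / n * ?T"
    by (simp only: T flip: sum_distrib_left)
  also have "\<dots> = ?T\<^sup>2 / n" by (simp add: power2_eq_square)
  finally have "(\<Sum>j<g. (?l j x)\<^sup>2 / (n * \<bar>?l j c\<bar> / ?T)) \<le> ?T\<^sup>2 / n" .
  from mult_left_mono[OF this, of "\<sigma>\<^sup>2"] show ?thesis
    by (simp add: design_variance_def hoel_levine_def T)
qed

theorem proposition18:
  fixes g :: nat and n \<sigma> c :: real
  assumes "g \<ge> 2" and "n > 0" and "\<sigma> > 0" and "c > 1"
  shows "minimax_optimal g n \<sigma> {1..c} (hoel_levine g n c)"
  unfolding minimax_optimal_def is_arg_min_linorder
proof (intro conjI allI impI)
  show "is_design g n (hoel_levine g n c)"
    using assms by (intro is_design_hoel_levine) auto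
next
  fix \<xi> assume \<xi>: "is_design g n \<xi>"
  let ?T = "poly (chebyshev_poly (g - 1)) c"
  \<comment> \<open>The middle value \<open>\<sigma>\<^sup>2 * ?T\<^sup>2 / n\<close> does not
    depend on the competing design \<open>\<xi>\<close>, so it separates the two maxima.\<close>
  have "max_design_variance g \<sigma> {1..c} (hoel_levine g n c) \<le> \<sigma>\<^sup>2 * ?T\<^sup>2 / n"
    unfolding max_design_variance_def using assms
    by (intro cSUP_least design_variance_hoel_levine_le) auto
  also have "\<bar>?T\<bar> \<le> (\<Sum>j<g. \<bar>lagrange g (fst \<xi>) j c\<bar>)"
    using \<xi> assms strict_mono_on_imp_inj_on[of "{..<g}" "fst \<xi>"]
    by (intro chebyshev_poly_le_sum_abs_lagrange) (auto simp: is_design_def)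
  then have "?T\<^sup>2 \<le> (\<Sum>j<g. \<bar>lagrange g (fst \<xi>) j c\<bar>)\<^sup>2"
    by (metis abs_ge_zero power2_abs power_mono)
  then have "\<sigma>\<^sup>2 * ?T\<^sup>2 / n \<le> \<sigma>\<^sup>2 * (\<Sum>j<g. \<bar>lagrange g (fst \<xi>) j c\<bar>)\<^sup>2 / n"
    using assms by (intro divide_right_mono mult_left_mono) auto
  also have "\<dots> \<le> design_variance g \<sigma> \<xi> c"
    using \<xi> assms by (intro design_variance_lower_bound)
  \<comment> \<open>The competitor is examined only at the endpoint \<open>c\<close> of the
    interval.\<close>
  also have "\<dots> \<le> max_design_variance g \<sigma> {1..c} \<xi>"
    using max_design_variance_attained[of 1 c g \<sigma> \<xi>] assms by force
  finally show "max_design_variance g \<sigma> {1..c} (hoel_levine g n c)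
      \<le> max_design_variance g \<sigma> {1..c} \<xi>" .
qed

end
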